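(* Let $R$ be a commutative ring with identity such that $2\in R^\times$, let $C\in\operatorname{Mat}_2(R)$ be cyclic, and put $\tau=\operatorname{tr}(C)$, $\nu=\det(C)$. Let $F\in\operatorname{GL}_2(R)$, let $K_1,\dots,K_m\in\operatorname{Orb}(C)$, and put $G_i=FK_i$ for $i=1,\dots,m$. Assume that either (1) the family $K_1,\dots,K_m$ is affinely saturated, or (2) $\tau=0$ and the family $K_1,\dots,K_m$ is linearly saturated. Then $$\operatorname{Cons}_C(G_1,\ldots,G_m)=\operatorname{Inv}_C(G_1,\ldots,G_m)=\{tF^{-1}:t\in\Sigma_C(R)\}=\{tF^{-1}:t\in R^\times,\ (t-1)\tau=0,\ (t^2-1)\nu=0\}.$$
   Context: A matrix $C\in\operatorname{Mat}_2(R)$ is cyclic if there exists $v\in R^2$ such that $(v,Cv)$ is an $R$-basis of $R^2$. $\operatorname{Orb}(C)=\{PCP^{-1}:P\in\operatorname{GL}_2(R)\}$ and $\mathfrak{sl}_2(R)=\{X\in\operatorname{Mat}_2(R):\operatorname{tr}(X)=0\}$. A family $K_1,\dots,K_m\in\operatorname{Orb}(C)$ (with $m\ge 1$) is affinely saturated if $\operatorname{span}_R\{K_i-K_1:i=2,\ldots,m\}=\mathfrak{sl}_2(R)$. If $\operatorname{tr}(C)=0$, it is linearly saturated if $\operatorname{span}_R\{K_1,\ldots,K_m\}=\mathfrak{sl}_2(R)$. The scalar-symmetry group is $\Sigma_C(R):=\{t\in R^\times:tC\text{ is similar to }C\text{ over }R\}$. The orbit-consistency set is $\operatorname{Cons}_C(G_1,\ldots,G_m):=\{U\in\operatorname{GL}_2(R):UG_i\in\operatorname{Orb}(C)\text{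 for all }i\}$, and the invariant-consistency set is $\operatorname{Inv}_C(G_1,\ldots,G_m):=\{U\in\operatorname{GL}_2(R):\operatorname{tr}(UG_i)=\tau\ (i=1,\ldots,m),\ \det(UG_1)=\nu\}$. *)

theory Defs
  imports "HOL-Analysis.Determinants"
begin

type_synonym 'a mat2 = "'a^2^2"

definition smult_mat :: "'a::comm_ring_1 \<Rightarrow> 'a mat2 \<Rightarrow> 'a mat2"  (infixr "\<cdot>m" 75)
  where "t \<cdot>m A = map_matrix (\<lambda>x. t * x) A"

text \<open>The library interprets \<open>module\<close> for vectors and matrices only over fields (or the reals).
  The next two lemmas make the facts about \<open>module.span\<close> available over a commutative ring.\<close>

lemma module_vec: "module (vector_scalar_mult :: 'a::comm_ring_1 \<Rightarrow> 'a^2 \<Rightarrow> 'a^2)"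
  by unfold_locales (simp_all add: vec_eq_iff algebra_simps)

lemma module_mat2: "module (smult_mat :: 'a::comm_ring_1 \<Rightarrow> 'a mat2 \<Rightarrow> 'a mat2)"
  by unfold_locales (simp_all add: smult_mat_def vec_eq_iff algebra_simps)

text \<open>Linear independence is stated for the ordered pair rather than through
  \<open>module.independent\<close> of the set \<open>{v, w}\<close>, which would collapse when \<open>v = w\<close>.\<close>

definition basis_pair :: "'a::comm_ring_1^2 \<Rightarrow> 'a^2 \<Rightarrow> bool" where
  "basis_pair v w \<longleftrightarrow>
     (\<forall>a b. a *s v + b *s w = 0 \<longrightarrow> a = 0 \<and> b = 0) \<and>
     module.span vector_scalar_mult {v, w} = UNIV"

definition cyclic_mat :: "'a::comm_ring_1 mat2 \<Rightarrow> bool" where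
  "cyclic_mat C \<longleftrightarrow> (\<exists>v. basis_pair v (C *v v))"

definition ring_units :: "'a::comm_ring_1 set" where
  "ring_units = {t. t dvd 1}"

definition GL2 :: "'a::comm_ring_1 mat2 set" where
  "GL2 = {P. invertible P}"

definition sl2 :: "'a::comm_ring_1 mat2 set" where
  "sl2 = {X. trace X = 0}"

definition Orb :: "'a::comm_ring_1 mat2 \<Rightarrow> 'a mat2 set" where
  "Orb C = {P ** C ** matrix_inv P | P. P \<in> GL2}"

text \<open>A family \<open>K\<^sub>1, \<dots>, K\<^sub>m\<close> is a function on \<open>nat\<close>, of which only the values at
  \<open>{1..m}\<close> are used. That its members lie in \<open>Orb C\<close> is part of both notions of saturation.\<close>

definition affinely_saturated :: "'a::comm_ring_1 mat2 \<Rightarrow> nat \<Rightarrow> (nat \<Rightarrow> 'a mat2) \<Rightarrow> bool" where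
  "affinely_saturated C m K \<longleftrightarrow>
     1 \<le> m \<and> (\<forall>i\<in>{1..m}. K i \<in> Orb C) \<and>
     module.span smult_mat {K i - K 1 | i. i \<in> {2..m}} = sl2"

definition linearly_saturated :: "'a::comm_ring_1 mat2 \<Rightarrow> nat \<Rightarrow> (nat \<Rightarrow> 'a mat2) \<Rightarrow> bool" where
  "linearly_saturated C m K \<longleftrightarrow>
     1 \<le> m \<and> trace C = 0 \<and> (\<forall>i\<in>{1..m}. K i \<in> Orb C) \<and>
     module.span smult_mat {K i | i. i \<in> {1..m}} = sl2"

definition similar_mat :: "'a::comm_ring_1 mat2 \<Rightarrow> 'a mat2 \<Rightarrow> bool" where
  "similar_mat A B \<longleftrightarrow> (\<exists>P\<in>GL2. A = P ** B ** matrix_inv P)"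

definition Sigma_sym :: "'a::comm_ring_1 mat2 \<Rightarrow> 'a set" where
  "Sigma_sym C = {t \<in> ring_units. similar_mat (t \<cdot>m C) C}"

definition Cons_set :: "'a::comm_ring_1 mat2 \<Rightarrow> nat \<Rightarrow> (nat \<Rightarrow> 'a mat2) \<Rightarrow> 'a mat2 set" where
  "Cons_set C m G = {U \<in> GL2. \<forall>i\<in>{1..m}. U ** G i \<in> Orb C}"

definition Inv_set :: "'a::comm_ring_1 mat2 \<Rightarrow> nat \<Rightarrow> (nat \<Rightarrow> 'a mat2) \<Rightarrow> 'a mat2 set" where
  "Inv_set C m G =
     {U \<in> GL2. (\<forall>i\<in>{1..m}. trace (U ** G i) = trace C) \<and> det (U ** G 1) = det C}"

end

theory Submission
  imports Defs
begin

text \<open>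
  Multiplying by \<open>F\<close> on the right turns the problem for \<open>U\<close> into one for \<open>V = U F\<close>, because
  \<open>U G\<^sub>i = V K\<^sub>i\<close>. The sets then lie in a cycle of inclusions.

  Similar matrices have the same trace and determinant, so consistency with the orbit gives
  consistency with the invariants. If conversely \<open>tr (V K\<^sub>i) = \<tau>\<close> for all \<open>i\<close>, then the linear
  functional \<open>X \<mapsto> tr (V X)\<close> vanishes on all \<open>K\<^sub>i - K\<^sub>1\<close>, and on all \<open>K\<^sub>i\<close> if \<open>\<tau> = 0\<close>. Saturation
  says that these matrices span the traceless matrices, whose orthogonal complement under the
  trace form consists of the scalar matrices (\<open>scalar_if_trace_orthogonal_sl2\<close>). Hence \<open>V = t I\<close>,
  where \<open>t\<close> is a unit because \<open>V\<close> is invertible, and the conditions on the trace and the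
  determinant of \<open>V K\<^sub>1 = t K\<^sub>1\<close> become \<open>t \<tau> = \<tau>\<close> and \<open>t\<^sup>2 \<nu> = \<nu>\<close>.

  It remains to see that these two equations make \<open>t C\<close> similar to \<open>C\<close>. This is where cyclicity
  enters: in the basis \<open>(v, C v)\<close> a cyclic matrix becomes the companion matrix of its characteristic
  polynomial, so cyclic matrices with equal trace and determinant are similar
  (\<open>cyclic_similar_if_same_invariants\<close>). A unit multiple of a cyclic matrix is again cyclic, and the
  two equations say that \<open>t C\<close> has the trace and determinant of \<open>C\<close>. Finally, if \<open>t C\<close> is similar to \<open>C\<close>, then
  \<open>t K\<^sub>i\<close> is similar to \<open>t C\<close> and so lies in the orbit of \<open>C\<close>, which closes the cycle.
\<close>

section \<open>Scalar multiples, inverses and similarity over a commutative ring\<close>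

lemmas mat2_entrywise = vec_eq_iff forall_2 sum_2 matrix_matrix_mult_def
  matrix_vector_mult_def smult_mat_def mat_def trace_def det_2

lemma smult_mat_mult_left: "(t \<cdot>m A) ** B = t \<cdot>m (A ** B)"
  and smult_mat_mult_right: "A ** (t \<cdot>m B) = t \<cdot>m (A ** B)"
  for A B :: "'a::comm_ring_1 mat2"
  by (simp_all add: mat2_entrywise algebra_simps)

lemma smult_mat_smult: "s \<cdot>m (t \<cdot>m A) = (s * t) \<cdot>m A"
  and smult_mat_one: "1 \<cdot>m A = A"
  for A :: "'a::comm_ring_1 mat2"
  by (simp_all add: mat2_entrywise algebra_simps)

lemma trace_smult_mat: "trace (t \<cdot>m A) = t * trace A"
  and det_smult_mat: "det (t \<cdot>m A) = t\<^sup>2 * det A"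
  for A :: "'a::comm_ring_1 mat2"
  by (simp_all add: mat2_entrywise algebra_simps power2_eq_square)

lemma ring_unitsE:
  assumes "t \<in> ring_units"
  obtains s where "t * s = 1" "s * t = 1"
  using assms by (auto simp: ring_units_def dvd_def mult.commute)

lemma matrix_inv_GL2:
  assumes "P \<in> GL2"
  shows "P ** matrix_inv P = mat 1" "matrix_inv P ** P = mat 1"
proof -
  have "\<exists>Q. P ** Q = mat 1 \<and> Q ** P = mat 1"
    using assms by (simp add: GL2_def invertible_def)
  then have "P ** matrix_inv P = mat 1 \<and> matrix_inv P ** P = mat 1"
    unfolding matrix_inv_def by (rule someI_ex)
  then show "P ** matrix_inv P = mat 1" "matrix_inv P ** P = mat 1"
    by blast+
qed

lemma GL2_I: "P ** Q = mat 1 \<Longrightarrow> Q ** P = mat 1 \<Longrightarrow> P \<in> GL2"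
  unfolding GL2_def invertible_def by blast

lemma matrix_inv_eqI:
  fixes P Q :: "'a::comm_ring_1 mat2"
  assumes "P ** Q = mat 1" "Q ** P = mat 1"
  shows "matrix_inv P = Q"
proof -
  have "P \<in> GL2"
    using assms by (rule GL2_I)
  then have "Q ** (P ** matrix_inv P) = Q"
    by (simp only: matrix_inv_GL2 matrix_mul_rid)
  then show ?thesis
    by (simp only: matrix_mul_assoc assms matrix_mul_lid)
qed

text \<open>With the inverse as an explicit witness, the laws of an equivalence relation become
  plain identities between products.\<close>

lemma similar_mat_iff:
  "similar_mat A B \<longleftrightarrow> (\<exists>P Q. P ** Q = mat 1 \<and> Q ** P = mat 1 \<and> A = P ** B ** Q)"
proof
  assume "similar_mat A B"
  then show "\<exists>P Q. P ** Q = mat 1 \<and> Q ** P = mat 1 \<and> A = P ** B ** Q"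
    unfolding similar_mat_def using matrix_inv_GL2 by blast
next
  assume "\<exists>P Q. P ** Q = mat 1 \<and> Q ** P = mat 1 \<and> A = P ** B ** Q"
  then obtain P Q where PQ: "P ** Q = mat 1" "Q ** P = mat 1" "A = P ** B ** Q"
    by blast
  then have "P \<in> GL2" "A = P ** B ** matrix_inv P"
    by (simp_all only: GL2_I matrix_inv_eqI)
  then show "similar_mat A B"
    unfolding similar_mat_def by blast
qed

lemma Orb_iff_similar: "A \<in> Orb C \<longleftrightarrow> similar_mat A C"
  by (auto simp: Orb_def similar_mat_def)

lemma similar_mat_sym:
  assumes "similar_mat A B"
  shows "similar_mat B A"
proof -
  obtain P Q where PQ: "P ** Q = mat 1" "Q ** P = mat 1" "A = P ** B ** Q"
    using assms by (auto simp: similar_mat_iff)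
  have "Q ** A ** P = (Q ** P) ** B ** (Q ** P)"
    by (simp add: PQ(3) matrix_mul_assoc)
  then have "B = Q ** A ** P"
    by (simp add: PQ(2) matrix_mul_lid matrix_mul_rid)
  with PQ(1,2) show ?thesis
    unfolding similar_mat_iff by blast
qed

lemma similar_mat_trans:
  assumes "similar_mat A B" "similar_mat B D"
  shows "similar_mat A D"
proof -
  obtain P Q where PQ: "P ** Q = mat 1" "Q ** P = mat 1" "A = P ** B ** Q"
    using assms(1) by (auto simp: similar_mat_iff)
  obtain P' Q' where PQ': "P' ** Q' = mat 1" "Q' ** P' = mat 1" "B = P' ** D ** Q'"
    using assms(2) by (auto simp: similar_mat_iff)
  have "(P ** P') ** (Q' ** Q) = P ** (P' ** Q') ** Q"
    and "(Q' ** Q) ** (P ** P') = Q' ** (Q ** P) ** P'"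
    and A: "A = (P ** P') ** D ** (Q' ** Q)"
    by (simp_all only: PQ(3) PQ'(3) matrix_mul_assoc)
  then have "(P ** P') ** (Q' ** Q) = mat 1" "(Q' ** Q) ** (P ** P') = mat 1"
    by (simp_all only: PQ(1,2) PQ'(1,2) matrix_mul_rid)
  with A show ?thesis
    unfolding similar_mat_iff by blast
qed

lemma similar_mat_smult:
  assumes "similar_mat A B"
  shows "similar_mat (t \<cdot>m A) (t \<cdot>m B)"
proof -
  obtain P Q where PQ: "P ** Q = mat 1" "Q ** P = mat 1" "A = P ** B ** Q"
    using assms by (auto simp: similar_mat_iff)
  have "t \<cdot>m A = P ** (t \<cdot>m B) ** Q"
    by (simp only: PQ(3) smult_mat_mult_left smult_mat_mult_right)
  with PQ(1,2) show ?thesis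
    unfolding similar_mat_iff by blast
qed

lemma similar_mat_trace_det:
  assumes "similar_mat A B"
  shows "trace A = trace B" "det A = det B"
proof -
  obtain P Q where PQ: "P ** Q = mat 1" "Q ** P = mat 1" "A = P ** B ** Q"
    using assms by (auto simp: similar_mat_iff)
  have "trace A = trace (Q ** P ** B)"
    using trace_mul_sym[of "P ** B" Q] by (simp add: PQ(3) matrix_mul_assoc)
  then show "trace A = trace B"
    by (simp add: PQ(2) matrix_mul_lid)
  have "det P * det Q = 1"
    using arg_cong[OF PQ(1), of det] by (simp only: det_mul det_I)
  moreover have "det A = (det P * det Q) * det B"
    by (simp add: PQ(3) det_mul algebra_simps)
  ultimately show "det A = det B"
    by simp
qed

section \<open>Cyclic matrices are classified by trace and determinant\<close>

definition mat_of_columns :: "'a::comm_ring_1^2 \<Rightarrow> 'a^2 \<Rightarrow> 'a mat2" where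
  "mat_of_columns v w = (\<chi> i j. if j = 1 then v $ i else w $ i)"

lemma mat_of_columns_mult_vec: "mat_of_columns v w *v x = (x $ 1) *s v + (x $ 2) *s w"
  by (simp add: mat2_entrywise mat_of_columns_def algebra_simps)

lemma span_pair_iff:
  "x \<in> module.span vector_scalar_mult {v, w} \<longleftrightarrow> (\<exists>a b. x = a *s v + b *s w)"
  for v w x :: "'a::comm_ring_1^2"
proof -
  interpret vec: module "vector_scalar_mult :: 'a \<Rightarrow> 'a^2 \<Rightarrow> 'a^2"
    by (rule module_vec)
  have "x - a *s v = b *s w \<longleftrightarrow> x = a *s v + b *s w" for a b
    by (auto simp: algebra_simps)
  then show ?thesis
    by (simp add: vec.span_insert[of v "{w}"] vec.span_singleton image_iff)
qed

text \<open>Spanning gives a right inverse of the matrix with columns \<open>v\<close> and \<open>w\<close>; linear independence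
  makes the matrix injective, so that the right inverse is also a left inverse.\<close>

lemma mat_of_basis_invertible:
  fixes v w :: "'a::comm_ring_1^2"
  assumes "basis_pair v w"
  shows "mat_of_columns v w \<in> GL2"
proof -
  let ?P = "mat_of_columns v w"
  have surj: "\<exists>x. ?P *v x = y" for y
  proof -
    have "y \<in> module.span vector_scalar_mult {v, w}"
      using assms by (simp add: basis_pair_def)
    then obtain a b where "y = a *s v + b *s w"
      unfolding span_pair_iff by blast
    then have "?P *v vector [a, b] = y"
      by (simp add: mat_of_columns_mult_vec)
    then show ?thesis ..
  qed
  have inj: "x = y" if "?P *v x = ?P *v y" for x y
  proof -
    have "(x $ 1 - y $ 1) *s v + (x $ 2 - y $ 2) *s w = 0"
      using that by (simp add: mat_of_columns_mult_vec vec_eq_iff algebra_simps)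
    then have "x $ 1 - y $ 1 = 0 \<and> x $ 2 - y $ 2 = 0"
      using assms unfolding basis_pair_def by blast
    then show ?thesis
      by (simp add: vec_eq_iff forall_2)
  qed
  obtain g where g: "\<And>y. ?P *v g y = y"
    using surj by metis
  define B where "B = mat_of_columns (g (axis 1 1)) (g (axis 2 1))"
  have "?P *v (B *v x) = x" for x
  proof -
    have scale: "?P *v (c *s y) = c *s (?P *v y)" for c y
      by (simp add: mat2_entrywise algebra_simps)
    have "?P *v (B *v x) = (x $ 1) *s axis 1 1 + (x $ 2) *s axis 2 1"
      by (simp only: B_def mat_of_columns_mult_vec[of "g (axis 1 1)"]
          matrix_vector_right_distrib scale g)
    then show ?thesis
      by (simp add: vec_eq_iff forall_2 axis_def)
  qed
  then have PB: "?P ** B = mat 1"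
    by (simp add: matrix_eq matrix_vector_mul_assoc[symmetric])
  have "(B ** ?P) *v x = mat 1 *v x" for x
  proof (rule inj)
    have "?P *v ((B ** ?P) *v x) = (?P ** B) *v (?P *v x)"
      by (simp only: matrix_vector_mul_assoc matrix_mul_assoc)
    then show "?P *v ((B ** ?P) *v x) = ?P *v (mat 1 *v x)"
      by (simp only: PB matrix_vector_mul_lid)
  qed
  then have "B ** ?P = mat 1"
    by (simp add: matrix_eq)
  with PB show ?thesis
    by (rule GL2_I)
qed

definition companion2 :: "'a::comm_ring_1 \<Rightarrow> 'a \<Rightarrow> 'a mat2" where
  "companion2 \<tau> \<nu> = vector [vector [0, -\<nu>], vector [1, \<tau>]]"

text \<open>In the basis \<open>(v, C v)\<close> the first column of \<open>C\<close> is \<open>(0, 1)\<close>, and by the Cayley-Hamilton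
  identity \<open>C (C v) = \<tau> (C v) - \<nu> v\<close> the second one is \<open>(-\<nu>, \<tau>)\<close>.\<close>

lemma cyclic_similar_companion2:
  assumes "cyclic_mat C"
  shows "similar_mat C (companion2 (trace C) (det C))"
proof -
  obtain v where "basis_pair v (C *v v)"
    using assms by (auto simp: cyclic_mat_def)
  define P where "P = mat_of_columns v (C *v v)"
  have P: "P \<in> GL2"
    unfolding P_def by (rule mat_of_basis_invertible) fact
  have "C ** P = P ** companion2 (trace C) (det C)"
    by (simp add: P_def mat_of_columns_def companion2_def mat2_entrywise algebra_simps)
  then have "C ** (P ** matrix_inv P) = P ** companion2 (trace C) (det C) ** matrix_inv P"
    by (simp add: matrix_mul_assoc)
  then have "C = P ** companion2 (trace C) (det C) ** matrix_inv P"
    by (simp add: matrix_inv_GL2[OF P] matrix_mul_rid)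
  with P show ?thesis
    unfolding similar_mat_def by blast
qed

lemma cyclic_similar_if_same_invariants:
  assumes "cyclic_mat A" "cyclic_mat B" "trace A = trace B" "det A = det B"
  shows "similar_mat A B"
  using cyclic_similar_companion2[OF assms(1)] cyclic_similar_companion2[OF assms(2)]
  by (auto simp: assms(3,4) intro: similar_mat_trans similar_mat_sym)

text \<open>The same vector \<open>v\<close> serves: for a unit \<open>t\<close>, replacing \<open>C v\<close> by \<open>t (C v)\<close> keeps a basis.\<close>

lemma cyclic_mat_smult_unit:
  fixes C :: "'a::comm_ring_1 mat2"
  assumes "cyclic_mat C" "t \<in> ring_units"
  shows "cyclic_mat (t \<cdot>m C)"
proof -
  obtain s where s: "t * s = 1" "s * t = 1"
    using assms(2) by (rule ring_unitsE)
  obtain v where v: "basis_pair v (C *v v)"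
    using assms(1) by (auto simp: cyclic_mat_def)
  have tCv: "(t \<cdot>m C) *v v = t *s (C *v v)"
    by (simp add: mat2_entrywise algebra_simps)
  have "a = 0 \<and> b = 0" if "a *s v + b *s (t *s (C *v v)) = 0" for a b
  proof -
    have "a *s v + (b * t) *s (C *v v) = 0"
      using that by (simp only: vector_smult_assoc)
    then have "a = 0 \<and> b * t = 0"
      using v unfolding basis_pair_def by blast
    then show ?thesis
      by (metis s(1) mult.assoc mult.right_neutral mult_zero_left)
  qed
  moreover have "x \<in> module.span vector_scalar_mult {v, t *s (C *v v)}" for x
  proof -
    have "x \<in> module.span vector_scalar_mult {v, C *v v}"
      using v by (simp add: basis_pair_def)
    then obtain a b where "x = a *s v + b *s (C *v v)"
      unfolding span_pair_iff by blast
    then have "x = a *s v + (b * s) *s (t *s (C *v v))"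
      by (simp add: vector_smult_assoc s mult.assoc)
    then show ?thesis
      unfolding span_pair_iff by blast
  qed
  ultimately have "basis_pair v ((t \<cdot>m C) *v v)"
    unfolding basis_pair_def tCv by blast
  then show ?thesis
    unfolding cyclic_mat_def by blast
qed

lemma Sigma_sym_iff:
  assumes "cyclic_mat C"
  shows "t \<in> Sigma_sym C \<longleftrightarrow>
    t \<in> ring_units \<and> (t - 1) * trace C = 0 \<and> (t\<^sup>2 - 1) * det C = 0"
proof -
  have "similar_mat (t \<cdot>m C) C \<longleftrightarrow> trace (t \<cdot>m C) = trace C \<and> det (t \<cdot>m C) = det C"
    if "t \<in> ring_units"
    using cyclic_similar_if_same_invariants[OF cyclic_mat_smult_unit[OF assms that] assms]
      similar_mat_trace_det by blast
  then show ?thesis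
    by (auto simp: Sigma_sym_def trace_smult_mat det_smult_mat algebra_simps)
qed

section \<open>The trace form and saturated families\<close>

text \<open>Pairing with the three matrices \<open>E\<^sub>1\<^sub>2\<close>, \<open>E\<^sub>2\<^sub>1\<close> and \<open>E\<^sub>1\<^sub>1 - E\<^sub>2\<^sub>2\<close> reads off the off-diagonal
  entries of \<open>V\<close> and the difference of its diagonal entries.\<close>

lemma scalar_if_trace_orthogonal_sl2:
  fixes V :: "'a::comm_ring_1 mat2"
  assumes "\<And>X. X \<in> sl2 \<Longrightarrow> trace (V ** X) = 0"
  shows "V = (V $ 1 $ 1) \<cdot>m mat 1"
proof -
  have "V $ 2 $ 1 = 0" "V $ 1 $ 2 = 0" "V $ 1 $ 1 - V $ 2 $ 2 = 0"
    using assms[of "vector [vector [0, 1], vector [0, 0]]"]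
      assms[of "vector [vector [0, 0], vector [1, 0]]"]
      assms[of "vector [vector [1, 0], vector [0, -1]]"]
    by (simp_all add: sl2_def mat2_entrywise)
  then show ?thesis
    by (simp add: mat2_entrywise)
qed

lemma trace_mult_zero_on_span:
  fixes V :: "'a::comm_ring_1 mat2"
  assumes "X \<in> module.span smult_mat S" and "\<And>Y. Y \<in> S \<Longrightarrow> trace (V ** Y) = 0"
  shows "trace (V ** X) = 0"
proof -
  interpret mat2: module "smult_mat :: 'a \<Rightarrow> 'a mat2 \<Rightarrow> 'a mat2"
    by (rule module_mat2)
  have "trace (V ** 0) = 0"
    by (simp add: mat2_entrywise)
  with assms(1) show ?thesis
    by (induction rule: mat2.span_induct_alt)
       (simp_all add: assms(2) matrix_add_ldistrib trace_add smult_mat_mult_right trace_smult_mat)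
qed

text \<open>The functional \<open>X \<mapsto> tr (V X)\<close> is constant on the family. In the affine case it therefore
  vanishes on the differences; in the linear case the constant \<open>tr C\<close> is itself \<open>0\<close>.\<close>

lemma scalar_if_saturated:
  fixes V :: "'a::comm_ring_1 mat2"
  assumes sat: "affinely_saturated C m K \<or> (trace C = 0 \<and> linearly_saturated C m K)"
    and tr: "\<And>i. i \<in> {1..m} \<Longrightarrow> trace (V ** K i) = trace C"
  shows "V = (V $ 1 $ 1) \<cdot>m mat 1"
  using sat
proof
  assume aff: "affinely_saturated C m K"
  show ?thesis
  proof (rule scalar_if_trace_orthogonal_sl2, rule trace_mult_zero_on_span)
    show "X \<in> module.span smult_mat {K i - K 1 |i. i \<in> {2..m}}" if "X \<in> sl2" for X
      using that aff by (simp add: affinely_saturated_def)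
    have "trace (V ** (K i - K 1)) = trace (V ** K i) - trace (V ** K 1)" for i
      by (simp add: mat2_entrywise algebra_simps)
    then have "trace (V ** (K i - K 1)) = 0" if "i \<in> {2..m}" for i
      using that tr[of i] tr[of 1] by simp
    then show "trace (V ** Y) = 0" if "Y \<in> {K i - K 1 |i. i \<in> {2..m}}" for Y
      using that by blast
  qed
next
  assume lin: "trace C = 0 \<and> linearly_saturated C m K"
  show ?thesis
  proof (rule scalar_if_trace_orthogonal_sl2, rule trace_mult_zero_on_span)
    show "X \<in> module.span smult_mat {K i |i. i \<in> {1..m}}" if "X \<in> sl2" for X
      using that lin by (simp add: linearly_saturated_def)
    show "trace (V ** Y) = 0" if "Y \<in> {K i |i. i \<in> {1..m}}" for Y
      using that tr lin by auto
  qed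
qed

section \<open>Consistency sets of a saturated family\<close>

theorem theorem3p7:
  fixes C F :: "'a::comm_ring_1 mat2"
    and K G :: "nat \<Rightarrow> 'a mat2"
    and m :: nat
    and \<tau> \<nu> :: 'a
  assumes two_unit: "(2::'a) \<in> ring_units"
    and cyclic: "cyclic_mat C"
    and tau: "\<tau> = trace C"
    and nu: "\<nu> = det C"
    and F: "F \<in> GL2"
    and m: "1 \<le> m"
    and K: "\<forall>i\<in>{1..m}. K i \<in> Orb C"
    and G: "\<forall>i\<in>{1..m}. G i = F ** K i"
    and saturated: "affinely_saturated C m K \<or> (\<tau> = 0 \<and> linearly_saturated C m K)"
  shows "Cons_set C m G = Inv_set C m G
       \<and> Inv_set C m G = {t \<cdot>m matrix_inv F | t. t \<in> Sigma_sym C}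
       \<and> {t \<cdot>m matrix_inv F | t. t \<in> Sigma_sym C}
         = {t \<cdot>m matrix_inv F | t. t \<in> ring_units \<and> (t - 1) * \<tau> = 0 \<and> (t^2 - 1) * \<nu> = 0}"
proof -
  let ?F' = "matrix_inv F"
  note FF' = matrix_inv_GL2[OF F]
  have K_tr_det: "trace (K i) = \<tau>" "det (K i) = \<nu>" if "i \<in> {1..m}" for i
    using K that by (simp_all add: tau nu Orb_iff_similar similar_mat_trace_det)
  have "Cons_set C m G \<subseteq> Inv_set C m G"
    using m by (auto simp: Cons_set_def Inv_set_def Orb_iff_similar similar_mat_trace_det)
  moreover have "Inv_set C m G \<subseteq> {t \<cdot>m ?F' | t. t \<in> Sigma_sym C}"
  proof
    fix U assume "U \<in> Inv_set C m G"
    then have U: "U \<in> GL2" and detU: "det (U ** G 1) = \<nu>"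
      and trU: "\<And>i. i \<in> {1..m} \<Longrightarrow> trace (U ** G i) = \<tau>"
      by (auto simp: Inv_set_def tau nu)
    define V where "V = U ** F"
    define t where "t = V $ 1 $ 1"
    have UG: "U ** G i = V ** K i" if "i \<in> {1..m}" for i
      using G that by (simp add: V_def matrix_mul_assoc)
    have V: "V = t \<cdot>m mat 1"
      unfolding t_def using saturated trU UG
      by (intro scalar_if_saturated[of C m K V]) (simp_all add: tau)
    have "U ** (F ** ?F') = V ** ?F'"
      by (simp add: V_def matrix_mul_assoc)
    then have U_eq: "U = t \<cdot>m ?F'"
      by (simp add: FF' V smult_mat_mult_left matrix_mul_lid matrix_mul_rid)
    \<comment> \<open>The inverse of \<open>V = U F\<close> is \<open>F\<^sup>-\<^sup>1 U\<^sup>-\<^sup>1\<close>; its first diagonal entry inverts \<open>t\<close>.\<close>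
    have "t \<in> ring_units"
    proof -
      have "V ** (?F' ** matrix_inv U) = U ** (F ** ?F') ** matrix_inv U"
        by (simp add: V_def matrix_mul_assoc)
      also have "\<dots> = mat 1"
        by (simp add: FF' matrix_inv_GL2[OF U] matrix_mul_rid)
      finally have "t \<cdot>m (?F' ** matrix_inv U) = mat 1"
        by (simp add: V smult_mat_mult_left matrix_mul_lid)
      then have "1 = (t \<cdot>m (?F' ** matrix_inv U)) $ 1 $ 1"
        by (simp add: mat_def)
      then have "1 = t * (?F' ** matrix_inv U) $ 1 $ 1"
        by (simp add: smult_mat_def)
      then show ?thesis
        unfolding ring_units_def dvd_def by blast
    qed
    moreover have "U ** G 1 = t \<cdot>m K 1"
      using UG[of 1] m by (simp add: V smult_mat_mult_left matrix_mul_lid)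
    then have "t * \<tau> = \<tau>" "t\<^sup>2 * \<nu> = \<nu>"
      using trU[of 1] detU K_tr_det[of 1] m
      by (simp_all add: trace_smult_mat det_smult_mat)
    ultimately have "t \<in> Sigma_sym C"
      by (simp add: Sigma_sym_iff[OF cyclic] tau nu algebra_simps)
    with U_eq show "U \<in> {t \<cdot>m ?F' | t. t \<in> Sigma_sym C}"
      by blast
  qed
  moreover have "{t \<cdot>m ?F' | t. t \<in> Sigma_sym C} \<subseteq> Cons_set C m G"
  proof clarify
    fix t assume "t \<in> Sigma_sym C"
    then have t: "t \<in> ring_units" "similar_mat (t \<cdot>m C) C"
      by (auto simp: Sigma_sym_def)
    obtain s where "t * s = 1" "s * t = 1"
      using t(1) by (rule ring_unitsE)
    then have "t \<cdot>m ?F' \<in> GL2"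
      by (intro GL2_I[of _ "s \<cdot>m F"])
         (simp_all add: smult_mat_mult_left smult_mat_mult_right smult_mat_smult FF' smult_mat_one)
    moreover have "(t \<cdot>m ?F') ** G i \<in> Orb C" if i: "i \<in> {1..m}" for i
    proof -
      have "(t \<cdot>m ?F') ** G i = t \<cdot>m ((?F' ** F) ** K i)"
        using G i by (simp add: smult_mat_mult_left matrix_mul_assoc)
      also have "\<dots> = t \<cdot>m K i"
        by (simp add: FF' matrix_mul_lid)
      finally have eq: "(t \<cdot>m ?F') ** G i = t \<cdot>m K i" .
      have "similar_mat (K i) C"
        using K i unfolding Orb_iff_similar by blast
      then have "similar_mat (t \<cdot>m K i) C"
        using t(2) by (rule similar_mat_trans[OF similar_mat_smult])
      then show ?thesis
        unfolding Orb_iff_similar eq .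
    qed
    ultimately show "t \<cdot>m ?F' \<in> Cons_set C m G"
      by (simp add: Cons_set_def)
  qed
  moreover have "{t \<cdot>m ?F' | t. t \<in> Sigma_sym C}
      = {t \<cdot>m ?F' | t. t \<in> ring_units \<and> (t - 1) * \<tau> = 0 \<and> (t^2 - 1) * \<nu> = 0}"
    by (simp add: Sigma_sym_iff[OF cyclic] tau nu)
  ultimately show ?thesis
    by blast
qed

end
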